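(* Let $K$ be an algebraically closed non-archimedean field with valuation $v$, valuation ring $R$ and residue field $k$ with $\mathrm{char}(k)\neq2,3$. Let $E/K$ be an elliptic curve with $v(j(E))<0$, let $W$ be a minimal Weierstrass model of $E$ of the form $$y^2=x^3+b_2x^2+b_4x+b_6,$$ and let $P\in E[3](K)$ be a point that reduces to the singular point of the reduced curve $\overline{E}$ of $W$ and satisfies $x(P)=0$. Then the discriminant of the quadratic polynomial $b_2x^2+b_4x+b_6$ vanishes, that is, $b_4^2-4b_2b_6=0$. In other words, $W$ can be written as $$y^2=x^3+a(x-b)^2$$ for some $a,b\in R$.
   Context: $v:K^*\to\mathbb{R}$ is extended by $v(0)=\infty$; $R=\{z\in K: v(z)\ge0\}$, $\mathfrak{m}$ is its maximal ideal and $k=R/\mathfrak{m}$. An integral Weierstrass equation for $E$ is a Weierstrass equation $y^2+a_1xy+a_3y=x^3+a_2x^2+a_4x+a_6$ of $E$ with all $a_i\in R$. It is minimal (a minimal Weierstrass model) if the valuation $v(\Delta)$ of its discriminant is minimal among all integral Weierstrass equations for $E$. The reduced curve $\overline{E}/k$ is defined by reducing the $a_i$ modulo $\mathfrak{m}$. The reduction $\overline{P}\in\overline{E}(k)$ of $P\in E(K)$ is obtained by scaling projective coordinates $[x_0,y_0,z_0]$ of $P$ so that they lie in $R$ and at least one is a unit, and then reducing modulo $\mathfrak{m}$. When $v(j(E))<0$, the reduced curve $\overline{E}$ of a minimal model has a unique singular point, which is a node. $E[3](K)$ is the group of points $P\in E(K)$ with $3P=\mathcal{O}$, where $\mathcal{O}$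 is the point at infinity. *)

theory Defs
  imports
    "HOL-Computational_Algebra.Polynomial"
    "HOL-Library.Extended_Real"
begin

section \<open>Weierstrass equations\<close>

text \<open>
  \<open>Weierstrass a1 a2 a3 a4 a6\<close> is the equation
  \<open>y\<^sup>2 + a1 x y + a3 y = x\<^sup>3 + a2 x\<^sup>2 + a4 x + a6\<close>.
\<close>

datatype 'a weierstrass =
  Weierstrass (a\<^sub>1: 'a) (a\<^sub>2: 'a) (a\<^sub>3: 'a) (a\<^sub>4: 'a) (a\<^sub>6: 'a)

definition b\<^sub>2 :: "'a::comm_ring_1 weierstrass \<Rightarrow> 'a" where
  "b\<^sub>2 W = a\<^sub>1 W ^ 2 + 4 * a\<^sub>2 W"

definition b\<^sub>4 :: "'a::comm_ring_1 weierstrass \<Rightarrow> 'a" where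
  "b\<^sub>4 W = 2 * a\<^sub>4 W + a\<^sub>1 W * a\<^sub>3 W"

definition b\<^sub>6 :: "'a::comm_ring_1 weierstrass \<Rightarrow> 'a" where
  "b\<^sub>6 W = a\<^sub>3 W ^ 2 + 4 * a\<^sub>6 W"

definition b\<^sub>8 :: "'a::comm_ring_1 weierstrass \<Rightarrow> 'a" where
  "b\<^sub>8 W = a\<^sub>1 W ^ 2 * a\<^sub>6 W + 4 * a\<^sub>2 W * a\<^sub>6 W - a\<^sub>1 W * a\<^sub>3 W * a\<^sub>4 W
            + a\<^sub>2 W * a\<^sub>3 W ^ 2 - a\<^sub>4 W ^ 2"

definition c\<^sub>4 :: "'a::comm_ring_1 weierstrass \<Rightarrow> 'a" where
  "c\<^sub>4 W = b\<^sub>2 W ^ 2 - 24 * b\<^sub>4 W"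

definition Disc :: "'a::comm_ring_1 weierstrass \<Rightarrow> 'a" where
  "Disc W = - (b\<^sub>2 W ^ 2) * b\<^sub>8 W - 8 * b\<^sub>4 W ^ 3 - 27 * b\<^sub>6 W ^ 2 + 9 * b\<^sub>2 W * b\<^sub>4 W * b\<^sub>6 W"

definition elliptic_curve :: "'a::field weierstrass \<Rightarrow> bool" where
  "elliptic_curve W \<longleftrightarrow> Disc W \<noteq> 0"

definition j_invariant :: "'a::field weierstrass \<Rightarrow> 'a" where
  "j_invariant W = c\<^sub>4 W ^ 3 / Disc W"

definition affine_eqn :: "'a::comm_ring_1 weierstrass \<Rightarrow> 'a \<Rightarrow> 'a \<Rightarrow> 'a" where
  "affine_eqn W x y =
     y ^ 2 + a\<^sub>1 W * x * y + a\<^sub>3 W * y - (x ^ 3 + a\<^sub>2 W * x ^ 2 + a\<^sub>4 W * x + a\<^sub>6 W)"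

text \<open>
  The equation obtained by the substitution \<open>x = u\<^sup>2 x' + r\<close>, \<open>y = u\<^sup>3 y' + s u\<^sup>2 x' + t\<close>
  (and division by \<open>u\<^sup>6\<close>); see the lemma following it.
\<close>

definition change_of_variables ::
    "'a::field \<Rightarrow> 'a \<Rightarrow> 'a \<Rightarrow> 'a \<Rightarrow> 'a weierstrass \<Rightarrow> 'a weierstrass" where
  "change_of_variables u r s t W = Weierstrass
     ((a\<^sub>1 W + 2 * s) / u)
     ((a\<^sub>2 W - s * a\<^sub>1 W + 3 * r - s ^ 2) / u ^ 2)
     ((a\<^sub>3 W + r * a\<^sub>1 W + 2 * t) / u ^ 3)
     ((a\<^sub>4 W - s * a\<^sub>3 W + 2 * r * a\<^sub>2 W - (t + r * s) * a\<^sub>1 W + 3 * r ^ 2 - 2 * s * t) / u ^ 4)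
     ((a\<^sub>6 W + r * a\<^sub>4 W + r ^ 2 * a\<^sub>2 W + r ^ 3 - t * a\<^sub>3 W - t ^ 2 - r * t * a\<^sub>1 W) / u ^ 6)"

lemma affine_eqn_change_of_variables:
  fixes u r s t x y :: "'a::field"
  assumes "u \<noteq> 0"
  shows "affine_eqn W (u ^ 2 * x + r) (u ^ 3 * y + s * u ^ 2 * x + t) =
         u ^ 6 * affine_eqn (change_of_variables u r s t W) x y"
  using assms unfolding affine_eqn_def change_of_variables_def
  by (simp add: field_simps) (simp add: eval_nat_numeral algebra_simps)

text \<open>
  An elliptic curve is given by one Weierstrass equation with non-zero discriminant; its other
  Weierstrass equations are those obtained from it by an admissible change of variables.
\<close>

definition weierstrass_equation_of :: "'a::field weierstrass \<Rightarrow> 'a weierstrass \<Rightarrow> bool" where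
  "weierstrass_equation_of E W \<longleftrightarrow> (\<exists>u r s t. u \<noteq> 0 \<and> W = change_of_variables u r s t E)"


section \<open>Rational points and the group law\<close>

datatype 'a point = Infinity | Affine 'a 'a

definition points :: "'a::field weierstrass \<Rightarrow> 'a point set" where
  "points W = insert Infinity {Affine x y |x y. affine_eqn W x y = 0}"

fun ec_add :: "'a::field weierstrass \<Rightarrow> 'a point \<Rightarrow> 'a point \<Rightarrow> 'a point" where
  "ec_add W Infinity Q = Q"
| "ec_add W (Affine x1 y1) Infinity = Affine x1 y1"
| "ec_add W (Affine x1 y1) (Affine x2 y2) =
     (if x1 = x2 \<and> y1 + y2 + a\<^sub>1 W * x2 + a\<^sub>3 W = 0 then Infinity
      else let
        \<comment> \<open>slope of the chord, or of the tangent line if the two points coincide\<close>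
        l = (if x1 = x2
             then (3 * x1 ^ 2 + 2 * a\<^sub>2 W * x1 + a\<^sub>4 W - a\<^sub>1 W * y1) / (2 * y1 + a\<^sub>1 W * x1 + a\<^sub>3 W)
             else (y2 - y1) / (x2 - x1));
        x3 = l ^ 2 + a\<^sub>1 W * l - a\<^sub>2 W - x1 - x2
      in Affine x3 (- (y1 + l * (x3 - x1)) - a\<^sub>1 W * x3 - a\<^sub>3 W))"

definition ec_mult :: "'a::field weierstrass \<Rightarrow> nat \<Rightarrow> 'a point \<Rightarrow> 'a point" where
  "ec_mult W n P = (ec_add W P ^^ n) Infinity"

definition torsion :: "'a::field weierstrass \<Rightarrow> nat \<Rightarrow> 'a point set" where
  "torsion W n = {P \<in> points W. ec_mult W n P = Infinity}"


section \<open>Points of the projective plane\<close>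

text \<open>A point of the projective plane is represented by the set of all its coordinate triples.\<close>

definition proj_point :: "'a::field \<Rightarrow> 'a \<Rightarrow> 'a \<Rightarrow> ('a \<times> 'a \<times> 'a) set" where
  "proj_point x y z = {(c * x, c * y, c * z) |c. c \<noteq> 0}"

fun to_proj :: "'a::field point \<Rightarrow> ('a \<times> 'a \<times> 'a) set" where
  "to_proj Infinity = proj_point 0 1 0"
| "to_proj (Affine x y) = proj_point x y 1"

text \<open>
  The homogeneous equation is \<open>F = Y\<^sup>2 Z + a1 X Y Z + a3 Y Z\<^sup>2 - X\<^sup>3 - a2 X\<^sup>2 Z - a4 X Z\<^sup>2 - a6 Z\<^sup>3\<close>;
  the last three conjuncts say that its partial derivatives by \<open>X\<close>, \<open>Y\<close> and \<open>Z\<close> vanish.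
\<close>

definition singular_point :: "'a::field weierstrass \<Rightarrow> ('a \<times> 'a \<times> 'a) set \<Rightarrow> bool" where
  "singular_point W Q \<longleftrightarrow> (\<exists>X Y Z. (X, Y, Z) \<noteq> (0, 0, 0) \<and> Q = proj_point X Y Z \<and>
     Y ^ 2 * Z + a\<^sub>1 W * X * Y * Z + a\<^sub>3 W * Y * Z ^ 2
       - X ^ 3 - a\<^sub>2 W * X ^ 2 * Z - a\<^sub>4 W * X * Z ^ 2 - a\<^sub>6 W * Z ^ 3 = 0 \<and>
     a\<^sub>1 W * Y * Z - 3 * X ^ 2 - 2 * a\<^sub>2 W * X * Z - a\<^sub>4 W * Z ^ 2 = 0 \<and>
     2 * Y * Z + a\<^sub>1 W * X * Z + a\<^sub>3 W * Z ^ 2 = 0 \<and>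
     Y ^ 2 + a\<^sub>1 W * X * Y + 2 * a\<^sub>3 W * Y * Z
       - a\<^sub>2 W * X ^ 2 - 2 * a\<^sub>4 W * X * Z - 3 * a\<^sub>6 W * Z ^ 2 = 0)"


section \<open>Valued fields and reduction\<close>

locale valued_field =
  fixes v :: "'a::field \<Rightarrow> ereal"
  assumes v_zero: "v 0 = \<infinity>"
    and v_real: "x \<noteq> 0 \<Longrightarrow> \<bar>v x\<bar> \<noteq> \<infinity>"
    and v_mult: "v (x * y) = v x + v y"
    and v_add: "min (v x) (v y) \<le> v (x + y)"

definition valuation_ring :: "('a::field \<Rightarrow> ereal) \<Rightarrow> 'a set" where
  "valuation_ring v = {z. 0 \<le> v z}"

definition maximal_ideal :: "('a::field \<Rightarrow> ereal) \<Rightarrow> 'a set" where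
  "maximal_ideal v = {z. 0 < v z}"

text \<open>
  The residue field \<open>k = R / m\<close> is given by a field type \<open>'k\<close> together with the quotient map:
  a surjective ring homomorphism \<open>res\<close> from \<open>R\<close> to \<open>'k\<close> with kernel \<open>m\<close>. The values of \<open>res\<close>
  outside \<open>R\<close> are irrelevant.
\<close>

locale residue_field = valued_field v
  for v :: "'a::field \<Rightarrow> ereal" +
  fixes res :: "'a \<Rightarrow> 'k::field"
  assumes res_one: "res 1 = 1"
    and res_add: "x \<in> valuation_ring v \<Longrightarrow> y \<in> valuation_ring v \<Longrightarrow> res (x + y) = res x + res y"
    and res_mult: "x \<in> valuation_ring v \<Longrightarrow> y \<in> valuation_ring v \<Longrightarrow> res (x * y) = res x * res y"
    and res_surj: "res ` valuation_ring v = UNIV"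
    and res_kernel: "{x \<in> valuation_ring v. res x = 0} = maximal_ideal v"

definition integral_weierstrass :: "('a::field \<Rightarrow> ereal) \<Rightarrow> 'a weierstrass \<Rightarrow> bool" where
  "integral_weierstrass v W \<longleftrightarrow> set_weierstrass W \<subseteq> valuation_ring v"

definition minimal_model :: "('a::field \<Rightarrow> ereal) \<Rightarrow> 'a weierstrass \<Rightarrow> 'a weierstrass \<Rightarrow> bool" where
  "minimal_model v E W \<longleftrightarrow>
     weierstrass_equation_of E W \<and> integral_weierstrass v W \<and>
     (\<forall>W'. weierstrass_equation_of E W' \<and> integral_weierstrass v W' \<longrightarrow> v (Disc W) \<le> v (Disc W'))"

definition reduced_curve :: "('a::field \<Rightarrow> 'k::field) \<Rightarrow> 'a weierstrass \<Rightarrow> 'k weierstrass" where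
  "reduced_curve res W = map_weierstrass res W"

text \<open>
  The reductions of all normalised coordinate triples of a point (all in \<open>R\<close>, one a unit) are
  exactly the coordinate triples of its reduction, because \<open>res\<close> maps \<open>R\<^sup>*\<close> onto \<open>k\<^sup>*\<close>.
\<close>

definition reduction ::
    "('a::field \<Rightarrow> ereal) \<Rightarrow> ('a \<Rightarrow> 'k::field) \<Rightarrow> 'a point \<Rightarrow> ('k \<times> 'k \<times> 'k) set" where
  "reduction v res P =
     {(res x, res y, res z) |x y z. (x, y, z) \<in> to_proj P \<and>
        {x, y, z} \<subseteq> valuation_ring v \<and> (\<exists>w\<in>{x, y, z}. v w = 0)}"

end

theory Submission
  imports Defs
begin

text \<open>
  The tangent at \<open>P = (0, y)\<close> has slope \<open>l = b4 / (2 y)\<close>, and \<open>3 P = O\<close> forces the third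
  intersection point to be \<open>P\<close> again, i.e. \<open>l\<^sup>2 = b2\<close>; as \<open>y\<^sup>2 = b6\<close>, the quadratic has discriminant
  zero. Its double root \<open>- b4 / (2 b2)\<close> is integral because \<open>b2\<close> is a unit: \<open>P\<close> reduces to the
  singular point, so \<open>b4\<close> and \<open>b6\<close> lie in the maximal ideal, and if \<open>b2\<close> did so too, then scaling
  by a \<open>u\<close> of minimal valuation among \<open>b2\<^sup>1\<^sup>/\<^sup>2\<close>, \<open>b4\<^sup>1\<^sup>/\<^sup>4\<close>, \<open>b6\<^sup>1\<^sup>/\<^sup>6\<close> would contradict minimality.
\<close>

section \<open>Changes of variables and the discriminant\<close>

lemma Disc_change_of_variables:
  fixes W :: "'a::field weierstrass"
  assumes "u \<noteq> 0"
  shows "u ^ 12 * Disc (change_of_variables u r s t W) = Disc W"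
proof -
  let ?W = "change_of_variables u r s t W"
  \<comment> \<open>Multiplying each coefficient by the power of \<open>u\<close> equal to its
    weight clears all denominators, so the remaining claims are polynomial identities.\<close>
  have a1: "u * a\<^sub>1 ?W = a\<^sub>1 W + 2 * s"
    and a2: "u ^ 2 * a\<^sub>2 ?W = a\<^sub>2 W - s * a\<^sub>1 W + 3 * r - s ^ 2"
    and a3: "u ^ 3 * a\<^sub>3 ?W = a\<^sub>3 W + r * a\<^sub>1 W + 2 * t"
    and a4: "u ^ 4 * a\<^sub>4 ?W = a\<^sub>4 W - s * a\<^sub>3 W + 2 * r * a\<^sub>2 W - (t + r * s) * a\<^sub>1 W
               + 3 * r ^ 2 - 2 * s * t"
    and a6: "u ^ 6 * a\<^sub>6 ?W = a\<^sub>6 W + r * a\<^sub>4 W + r ^ 2 * a\<^sub>2 W + r ^ 3 - t * a\<^sub>3 W - t ^ 2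
               - r * t * a\<^sub>1 W"
    using assms by (simp_all add: change_of_variables_def)
  have b2: "u ^ 2 * b\<^sub>2 ?W = b\<^sub>2 W + 12 * r"
  proof -
    have "u ^ 2 * b\<^sub>2 ?W = (u * a\<^sub>1 ?W) ^ 2 + 4 * (u ^ 2 * a\<^sub>2 ?W)"
      unfolding b\<^sub>2_def by algebra
    then show ?thesis
      unfolding a1 a2 b\<^sub>2_def by algebra
  qed
  have b4: "u ^ 4 * b\<^sub>4 ?W = b\<^sub>4 W + r * b\<^sub>2 W + 6 * r ^ 2"
  proof -
    have "u ^ 4 * b\<^sub>4 ?W = 2 * (u ^ 4 * a\<^sub>4 ?W) + (u * a\<^sub>1 ?W) * (u ^ 3 * a\<^sub>3 ?W)"
      unfolding b\<^sub>4_def by algebra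
    then show ?thesis
      unfolding a1 a3 a4 b\<^sub>4_def b\<^sub>2_def by algebra
  qed
  have b6: "u ^ 6 * b\<^sub>6 ?W = b\<^sub>6 W + 2 * r * b\<^sub>4 W + r ^ 2 * b\<^sub>2 W + 4 * r ^ 3"
  proof -
    have "u ^ 6 * b\<^sub>6 ?W = (u ^ 3 * a\<^sub>3 ?W) ^ 2 + 4 * (u ^ 6 * a\<^sub>6 ?W)"
      unfolding b\<^sub>6_def by algebra
    then show ?thesis
      unfolding a3 a6 b\<^sub>6_def b\<^sub>4_def b\<^sub>2_def by algebra
  qed
  have b8: "u ^ 8 * b\<^sub>8 ?W = b\<^sub>8 W + 3 * r * b\<^sub>6 W + 3 * r ^ 2 * b\<^sub>4 W + r ^ 3 * b\<^sub>2 W + 3 * r ^ 4"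
  proof -
    have "u ^ 8 * b\<^sub>8 ?W = (u * a\<^sub>1 ?W) ^ 2 * (u ^ 6 * a\<^sub>6 ?W) + 4 * (u ^ 2 * a\<^sub>2 ?W) * (u ^ 6 * a\<^sub>6 ?W)
        - (u * a\<^sub>1 ?W) * (u ^ 3 * a\<^sub>3 ?W) * (u ^ 4 * a\<^sub>4 ?W)
        + (u ^ 2 * a\<^sub>2 ?W) * (u ^ 3 * a\<^sub>3 ?W) ^ 2 - (u ^ 4 * a\<^sub>4 ?W) ^ 2"
      unfolding b\<^sub>8_def by algebra
    then show ?thesis
      unfolding a1 a2 a3 a4 a6 b\<^sub>8_def b\<^sub>6_def b\<^sub>4_def b\<^sub>2_def by algebra
  qed
  \<comment> \<open>The discriminant is invariant under the shift by \<open>r\<close> only modulo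
    this relation, because below \<open>b\<^sub>8 W\<close> is treated as an independent
    variable.\<close>
  have b8_rel: "4 * b\<^sub>8 W = b\<^sub>2 W * b\<^sub>6 W - b\<^sub>4 W ^ 2"
    unfolding b\<^sub>8_def b\<^sub>6_def b\<^sub>4_def b\<^sub>2_def by algebra
  have "u ^ 12 * Disc ?W = - ((u ^ 2 * b\<^sub>2 ?W) ^ 2) * (u ^ 8 * b\<^sub>8 ?W) - 8 * (u ^ 4 * b\<^sub>4 ?W) ^ 3
      - 27 * (u ^ 6 * b\<^sub>6 ?W) ^ 2 + 9 * (u ^ 2 * b\<^sub>2 ?W) * (u ^ 4 * b\<^sub>4 ?W) * (u ^ 6 * b\<^sub>6 ?W)"
    unfolding Disc_def by algebra
  also have "\<dots> = Disc W"
    unfolding b2 b4 b6 b8 unfolding Disc_def using b8_rel by algebra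
  finally show ?thesis .
qed

text \<open>A scaling applied last only multiplies the factor \<open>u'\<close>; the parameters
  \<open>r\<close>, \<open>s\<close>, \<open>t\<close> stay the same.\<close>

lemma weierstrass_equation_of_scale:
  assumes "weierstrass_equation_of E W" and "u \<noteq> 0"
  shows "weierstrass_equation_of E (change_of_variables u 0 0 0 W)"
proof -
  obtain u' r s t where "u' \<noteq> 0" and W: "W = change_of_variables u' r s t E"
    using assms(1) unfolding weierstrass_equation_of_def by blast
  have "change_of_variables u 0 0 0 W = change_of_variables (u' * u) r s t E"
    unfolding W by (simp add: change_of_variables_def power_mult_distrib)
  then show ?thesis
    using \<open>u' \<noteq> 0\<close> assms(2) unfolding weierstrass_equation_of_def
    by (metis mult_eq_0_iff)
qed

section \<open>Points of order 3 with x = 0\<close>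

lemma torsion_3_at_zero:
  fixes b2 b4 b6 y :: "'a::field"
  assumes "(2::'a) \<noteq> 0" and tors: "Affine 0 y \<in> torsion (Weierstrass 0 b2 0 b4 b6) 3"
  shows "y \<noteq> 0" and "y ^ 2 = b6" and "b4 ^ 2 - 4 * b2 * b6 = 0"
proof -
  let ?W = "Weierstrass 0 b2 0 b4 b6"
  show y2: "y ^ 2 = b6"
    using tors by (auto simp: torsion_def points_def affine_eqn_def)
  have triple: "ec_add ?W (Affine 0 y) (ec_add ?W (Affine 0 y) (Affine 0 y)) = Infinity"
    using tors by (simp add: torsion_def ec_mult_def numeral_3_eq_3)
  have double: "y + y = 2 * y"
    by algebra
  \<comment> \<open>If \<open>y = 0\<close>, then 2P = O, hence 3P = P, which is affine.\<close>
  show y: "y \<noteq> 0"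
    using triple by auto
  \<comment> \<open>The x-coordinate of 2P is \<open>l^2 - b2\<close> with
    \<open>l = b4 / (2 * y)\<close>; adding P can give O only if it equals x(P) = 0.\<close>
  have "(b4 / (2 * y)) ^ 2 = b2"
    using triple y assms(1) by (simp add: double Let_def split: if_splits)
  moreover have "b4 / (2 * y) * (2 * y) = b4"
    using y assms(1) by simp
  ultimately have "b4 ^ 2 = b2 * (2 * y) ^ 2"
    by (metis power_mult_distrib)
  then show "b4 ^ 2 - 4 * b2 * b6 = 0"
    unfolding y2[symmetric] by algebra
qed

lemma two_neq_zero:
  assumes "CHAR('k::field) \<noteq> 2"
  shows "(2::'k) \<noteq> 0"
proof
  assume "(2::'k) = 0"
  then have "CHAR('k) dvd 2"
    using of_nat_eq_0_iff_char_dvd[of 2, where ?'a = 'k] by simp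
  then have "CHAR('k) = 1 \<or> CHAR('k) = 2"
    using prime_nat_iff two_is_prime_nat by blast
  then show False
    using assms CHAR_not_1 by auto
qed

section \<open>Valuation arithmetic\<close>

context valued_field
begin

lemma v_one: "v 1 = 0"
  using v_mult[of 1 1] v_real[of 1] by (cases "v 1") auto

lemma v_divide_nonneg:
  assumes "y \<noteq> 0" and "v y \<le> v x"
  shows "0 \<le> v (x / y)"
  using assms v_mult[of "x / y" y] v_real[of y]
  by (cases "v (x / y)"; cases "v y"; cases "v x") auto

text \<open>The case \<open>x = 0\<close>, \<open>n = 0\<close> relies on the convention
  \<open>0 * \<infinity> = 0\<close> in \<open>ereal\<close>.\<close>

lemma v_power: "v (x ^ n) = ereal (real n) * v x"
proof (induction n)
  case (Suc n)
  then show ?case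
    by (cases "v x") (auto simp: v_mult algebra_simps)
qed (simp add: v_one)

lemma v_power_nonneg_iff:
  assumes "n > 0"
  shows "0 \<le> v (x ^ n) \<longleftrightarrow> 0 \<le> v x"
  using assms by (cases "v x") (auto simp: v_power zero_le_mult_iff)

lemma v_power_pos_iff:
  assumes "n > 0"
  shows "0 < v (x ^ n) \<longleftrightarrow> 0 < v x"
  using assms by (cases "v x") (auto simp: v_power zero_less_mult_iff)

end

section \<open>Reduction modulo the maximal ideal\<close>

context residue_field
begin

lemma res_eq_zero_iff:
  assumes "0 \<le> v x"
  shows "res x = 0 \<longleftrightarrow> 0 < v x"
proof -
  have "x \<in> {x \<in> valuation_ring v. res x = 0} \<longleftrightarrow> x \<in> maximal_ideal v"
    by (simp only: res_kernel)
  then show ?thesis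
    using assms by (simp add: valuation_ring_def maximal_ideal_def)
qed

lemma res_zero: "res 0 = 0"
  by (simp add: res_eq_zero_iff v_zero)

text \<open>Carries the condition on the residue field over to K: 2 is non-zero there, and even a
  unit of R, as the denominator of the double root requires.\<close>

lemma v_two:
  assumes "(2::'k) \<noteq> 0"
  shows "v 2 = 0"
proof -
  have R1: "1 \<in> valuation_ring v"
    by (simp add: valuation_ring_def v_one)
  have "res 2 = 2"
    using res_add[OF R1 R1] by (simp add: res_one)
  moreover have "0 \<le> v 2"
    using v_add[of 1 1] by (simp add: v_one)
  ultimately show ?thesis
    using assms res_eq_zero_iff[of 2] by (simp add: order_less_le)
qed

text \<open>The reduction is the affine point (0, \<open>res y\<close>). The Y-derivative forces
  \<open>Y = 0\<close>; then the X-derivative and the equation itself leave only the terms with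
  \<open>res b4\<close> and \<open>res b6\<close>.\<close>

lemma singular_reduction_at_zero:
  assumes two: "(2::'k) \<noteq> 0"
    and int: "0 \<le> v b4" "0 \<le> v b6" "0 \<le> v y"
    and sing: "singular_point (reduced_curve res (Weierstrass 0 b2 0 b4 b6))
                 (reduction v res (Affine 0 y))"
  shows "0 < v b4" and "0 < v b6"
proof -
  obtain X Y Z where Q: "reduction v res (Affine 0 y) = proj_point X Y Z"
    and eqs: "Y ^ 2 * Z - X ^ 3 - res b2 * X ^ 2 * Z - res b4 * X * Z ^ 2 - res b6 * Z ^ 3 = 0"
      "- (3 * X ^ 2) - 2 * res b2 * X * Z - res b4 * Z ^ 2 = 0"
      "2 * Y * Z = 0"
    using sing by (auto simp: singular_point_def reduced_curve_def res_zero)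
  \<comment> \<open>This triple is already normalised: \<open>y\<close> is integral and 1 is a
    unit.\<close>
  have "(0, y, 1) \<in> to_proj (Affine 0 y)"
    by (auto simp: proj_point_def)
  then have "(res 0, res y, res 1) \<in> reduction v res (Affine 0 y)"
    unfolding reduction_def using int
    by (fastforce simp: valuation_ring_def v_zero v_one)
  then have "X = 0" "Z \<noteq> 0"
    unfolding Q by (auto simp: proj_point_def res_zero res_one)
  moreover from this have "Y = 0"
    using eqs(3) two by simp
  ultimately have "res b4 = 0" "res b6 = 0"
    using eqs(1,2) by simp_all
  then show "0 < v b4" "0 < v b6"
    using int by (simp_all add: res_eq_zero_iff)
qed

end

section \<open>Minimality and the unit coefficient\<close>

lemma (in valued_field) minimal_model_unit_coeff:
  fixes b2 b4 b6 :: 'a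
  assumes "\<And>(x::'a) n. n > 0 \<Longrightarrow> \<exists>z. z ^ n = x"
    and "elliptic_curve E" and min: "minimal_model v E (Weierstrass 0 b2 0 b4 b6)"
    and pos: "0 < v b4" "0 < v b6" and "b6 \<noteq> 0"
  shows "v b2 = 0"
proof (rule ccontr)
  let ?W = "Weierstrass 0 b2 0 b4 b6"
  assume "v b2 \<noteq> 0"
  moreover have "0 \<le> v b2"
    using min by (simp add: minimal_model_def integral_weierstrass_def valuation_ring_def)
  ultimately have "0 < v b2"
    by simp
  \<comment> \<open>The exponents are the weights of the coefficients, so the rescaled coefficients
    become powers of \<open>p / u\<close>, \<open>q / u\<close> and \<open>w / u\<close>.\<close>
  obtain p q w where roots: "p ^ 2 = b2" "q ^ 4 = b4" "w ^ 6 = b6"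
    using assms(1)[of 2 b2] assms(1)[of 4 b4] assms(1)[of 6 b6] by auto
  have vpos: "0 < v p" "0 < v q" "0 < v w"
    using \<open>0 < v b2\<close> pos unfolding roots[symmetric] by (simp_all add: v_power_pos_iff)
  have "\<exists>u\<in>{p, q, w}. \<forall>z\<in>{p, q, w}. v u \<le> v z"
    using linear[of "v p" "v q"] linear[of "v p" "v w"] linear[of "v q" "v w"]
    by (auto intro: order_trans)
  then obtain u where u: "u \<in> {p, q, w}" "v u \<le> v p" "v u \<le> v q" "v u \<le> v w"
    by blast
  \<comment> \<open>\<open>p\<close> and \<open>q\<close> may vanish, but \<open>v w\<close> is
    finite, so the least valuation is finite too.\<close>
  have "w \<noteq> 0"
    using roots(3) \<open>b6 \<noteq> 0\<close> by auto
  then have "u \<noteq> 0"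
    using u(4) v_real[of w] v_zero by auto
  have "0 \<le> v (b2 / u ^ 2)" "0 \<le> v (b4 / u ^ 4)" "0 \<le> v (b6 / u ^ 6)"
    unfolding roots[symmetric] power_divide[symmetric]
    using u \<open>u \<noteq> 0\<close> by (simp_all add: v_power_nonneg_iff v_divide_nonneg)
  then have "integral_weierstrass v (change_of_variables u 0 0 0 ?W)"
    by (simp add: integral_weierstrass_def valuation_ring_def change_of_variables_def v_zero)
  moreover have "weierstrass_equation_of E ?W"
    using min by (simp add: minimal_model_def)
  moreover have "weierstrass_equation_of E (change_of_variables u 0 0 0 ?W)"
    using calculation(2) \<open>u \<noteq> 0\<close> by (rule weierstrass_equation_of_scale)
  ultimately have le: "v (Disc ?W) \<le> v (Disc (change_of_variables u 0 0 0 ?W))"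
    using min by (simp add: minimal_model_def)
  \<comment> \<open>The contradiction below cancels \<open>v (Disc ?W)\<close>, which must therefore
    be finite.\<close>
  have "Disc ?W \<noteq> 0"
  proof -
    obtain u' r s t where "u' \<noteq> 0" "?W = change_of_variables u' r s t E"
      using \<open>weierstrass_equation_of E ?W\<close> unfolding weierstrass_equation_of_def by blast
    then have "u' ^ 12 * Disc ?W = Disc E"
      by (metis Disc_change_of_variables)
    then show ?thesis
      using \<open>elliptic_curve E\<close> by (auto simp: elliptic_curve_def)
  qed
  have sum: "v (Disc ?W) = v (u ^ 12) + v (Disc (change_of_variables u 0 0 0 ?W))"
    using Disc_change_of_variables[OF \<open>u \<noteq> 0\<close>] v_mult by metis
  have "0 < v (u ^ 12)"
    using u(1) vpos by (auto simp: v_power_pos_iff)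
  moreover have "v (Disc ?W) + v (u ^ 12) \<le> v (Disc ?W)"
    using add_right_mono[OF le, of "v (u ^ 12)"] unfolding sum by (simp add: add.commute)
  ultimately show False
    using v_real[OF \<open>Disc ?W \<noteq> 0\<close>]
    by (cases "v (Disc ?W)"; cases "v (u ^ 12)") auto
qed

theorem lemma4p1:
  fixes v :: "'a::alg_closed_field \<Rightarrow> ereal"
    and res :: "'a \<Rightarrow> 'k::field"
    and E W :: "'a weierstrass"
    and b2 b4 b6 :: 'a
    and P :: "'a point"
  assumes "residue_field v res"
    and "CHAR('k) \<noteq> 2" and "CHAR('k) \<noteq> 3"
    and "elliptic_curve E"
    and "v (j_invariant E) < 0"
    and "minimal_model v E W"
    and "W = Weierstrass 0 b2 0 b4 b6"
    and "P \<in> torsion W 3"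
    and "singular_point (reduced_curve res W) (reduction v res P)"
    and "\<exists>y. P = Affine 0 y"
  shows "b4 ^ 2 - 4 * b2 * b6 = 0 \<and>
         (\<exists>a\<in>valuation_ring v. \<exists>b\<in>valuation_ring v.
            [:b6, b4, b2, 1:] = monom 1 3 + smult a ([:- b, 1:] ^ 2))"
proof -
  interpret residue_field v res
    by (fact assms(1))
  obtain y where P: "P = Affine 0 y"
    using assms(10) by blast
  note W = assms(7)
  have k2: "(2::'k) \<noteq> 0"
    using assms(2) by (rule two_neq_zero)
  have "v 2 = 0"
    using k2 by (rule v_two)
  then have K2: "(2::'a) \<noteq> 0"
    using v_zero by auto
  note tors = torsion_3_at_zero[OF K2 assms(8)[unfolded P W]]
  have int: "0 \<le> v b2" "0 \<le> v b4" "0 \<le> v b6"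
    using assms(6) unfolding W
    by (simp_all add: minimal_model_def integral_weierstrass_def valuation_ring_def)
  have "0 \<le> v y"
    using int(3) tors(2) v_power_nonneg_iff[of 2 y] by simp
  then have pos: "0 < v b4" "0 < v b6"
    using singular_reduction_at_zero[OF k2 int(2,3)] assms(9) unfolding P W by blast+
  have "b6 \<noteq> 0"
    using tors(1,2) by auto
  have "v b2 = 0"
  proof (rule minimal_model_unit_coeff)
    show "\<exists>z. z ^ n = x" if "n > 0" for x :: 'a and n
      using nth_root_exists[OF that] by blast
  qed (use assms(4,6) W pos \<open>b6 \<noteq> 0\<close> in simp_all)
  then have "v (2 * b2) = 0" and "b2 \<noteq> 0"
    using \<open>v 2 = 0\<close> v_zero by (auto simp: v_mult)
  define b where "b = - b4 / (2 * b2)"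
  \<comment> \<open>Since \<open>(-1) * (-1) = 1\<close>, twice the finite value
    \<open>v (-1)\<close> is 0.\<close>
  have "v (-b4) = v b4"
    using v_mult[of "-1" b4] v_mult[of "-1" "-1"] v_one v_real[of "-1"]
    by (cases "v (-1)") auto
  then have "b \<in> valuation_ring v"
    unfolding b_def valuation_ring_def mem_Collect_eq
    using K2 \<open>b2 \<noteq> 0\<close> int(2) \<open>v (2 * b2) = 0\<close> by (intro v_divide_nonneg) auto
  moreover have "b2 \<in> valuation_ring v"
    using int(1) by (simp add: valuation_ring_def)
  \<comment> \<open>The witness for \<open>a\<close> is \<open>b2\<close>. Substituting
    \<open>b4 = - (2 * b2 * b)\<close> into the vanishing discriminant and cancelling
    \<open>4 * b2\<close> gives the constant term.\<close>
  moreover have "[:b6, b4, b2, 1:] = monom 1 3 + smult b2 ([:- b, 1:] ^ 2)"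
  proof -
    have lin: "b4 = - (2 * b2 * b)"
      using K2 \<open>b2 \<noteq> 0\<close> by (simp add: b_def)
    have "4 * b2 * (b6 - b2 * b ^ 2) = 0"
      using tors(3) lin by algebra
    moreover have "(4::'a) \<noteq> 0"
      using K2 by (metis mult_2 mult_eq_0_iff numeral_Bit0)
    ultimately have "b6 = b2 * b ^ 2"
      using \<open>b2 \<noteq> 0\<close> by simp
    then show ?thesis
      using lin by (simp add: monom_altdef eval_nat_numeral algebra_simps)
  qed
  ultimately show ?thesis
    using tors(3) by blast
qed

end
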